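(* Consider the forward complete system $\dot x=f(x,d)$ with output $y=h(x)$ described in the context. Suppose that there exist continuously differentiable functions $V,W:\mathbb{R}^n\to\mathbb{R}_{\ge0}$ with $W(0)=0$, a function $a\in\mathcal{K}_\infty$, a continuous non-decreasing function $\chi:\mathbb{R}_{\ge0}\to\mathbb{R}_{\ge0}$ and a continuous positive definite function $\rho:\mathbb{R}_{\ge0}\to\mathbb{R}_{\ge0}$ such that, for all $x\in\mathbb{R}^n$ and all $d\in D$, $$a(|h(x)|)\le W(x),$$ $$W(x)\ge\chi(|d|)\ \Rightarrow\ \nabla V(x)f(x,d)\le-\rho(W(x)).$$ Assume further that, for all $x\in\mathbb{R}^n$ and all $d\in D$, $$W(x)\ge\chi(|d|)\ \Rightarrow\ \nabla W(x)f(x,d)\le 0.$$ Then the system is p-IOS with gain $a^{-1}\circ\chi$. In particular, if $\chi(0)=0$, then the system is IOS.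
   Context: Setting. $D\subseteq\mathbb{R}^m$ is closed with $0\in D$. The map $f:\mathbb{R}^n\times D\to\mathbb{R}^n$ is continuous with $f(0,0)=0$, and for every pair of compact sets $S\subseteq\mathbb{R}^n$, $K\subseteq D$ there is $L_{S,K}>0$ such that $|f(x,d)-f(z,d)|\le L_{S,K}|x-z|$ for all $x,z\in S$, $d\in K$. The output map $h:\mathbb{R}^n\to\mathbb{R}^k$ is continuous with $h(0)=0$. Consider $\dot x=f(x,d)$, $y=h(x)$. The system is assumed forward complete: for every $x_0\in\mathbb{R}^n$ and every measurable, locally essentially bounded $d:\mathbb{R}_{\ge0}\to D$ the unique solution $\phi(t,x_0;d)$ with $\phi(0,x_0;d)=x_0$ exists for all $t\ge0$. Write $y(t,x_0;d):=h(\phi(t,x_0;d))$. Notation. $|\cdot|$ is the Euclidean norm; $L^\infty(\mathbb{R}_{\ge0};D)$ is the set of measurable essentially bounded $d:\mathbb{R}_{\ge0}\to D$, and $\|d\|_\infty=\mathrm{ess\,sup}_{t\ge0}|d(t)|$. $\mathcal{K}$ is the set of continuous (strictly) increasing $\alpha:\mathbb{R}_{\ge0}\to\mathbb{R}_{\ge0}$ with $\alpha(0)=0$; $\mathcal{K}_\infty$ is the set of $\alpha\in\mathcal{K}$ with $\lim_{s\to+\infty}\alpha(s)=+\infty$. $\beta:\mathbb{R}_{\ge0}\times\mathbb{R}_{\ge0}\to\mathbb{R}_{\ge0}$ is of class $\mathcal{KL}$ if $\beta(\cdot,t)\in\mathcal{K}$ for each fixed $t\ge0$ and, for each fixed $s\ge0$,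 $\beta(s,\cdot)$ is continuous, non-increasing and tends to $0$ at infinity. A function $\rho:\mathbb{R}_{\ge0}\to\mathbb{R}_{\ge0}$ is positive definite if $\rho(0)=0$ and $\rho(s)>0$ for $s>0$. Definitions. The system is practically input-to-output stable (p-IOS) with gain $\gamma$, where $\gamma:\mathbb{R}_{\ge0}\to\mathbb{R}_{\ge0}$ is continuous and non-decreasing, if there exists $\beta\in\mathcal{KL}$ such that for all $x_0\in\mathbb{R}^n$ and all $d\in L^\infty(\mathbb{R}_{\ge0};D)$, $$|y(t,x_0;d)|\le\beta(|x_0|,t)+\gamma(\|d\|_\infty)\quad\text{for all }t\ge0.$$ It is input-to-output stable (IOS) if this holds for some such $\gamma$ with $\gamma(0)=0$. *)

theory Defs
  imports "HOL-Analysis.Analysis" "HOL-Probability.Essential_Supremum"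
begin

text \<open>
  Functions on the nonnegative reals are total functions on \<^typ>\<open>real\<close>; only their values
  on \<^term>\<open>{0::real..}\<close> are constrained or used.
\<close>

subsection \<open>Comparison functions\<close>

text \<open>Nonnegativity on \<^term>\<open>{0::real..}\<close> follows from monotonicity and \<^prop>\<open>\<alpha> 0 = (0::real)\<close>.\<close>

definition class_K :: "(real \<Rightarrow> real) \<Rightarrow> bool" where
  "class_K \<alpha> \<longleftrightarrow> continuous_on {0..} \<alpha> \<and> strict_mono_on {0..} \<alpha> \<and> \<alpha> 0 = 0"

definition class_K_inf :: "(real \<Rightarrow> real) \<Rightarrow> bool" where
  "class_K_inf \<alpha> \<longleftrightarrow> class_K \<alpha> \<and> filterlim \<alpha> at_top at_top"

definition class_KL :: "(real \<Rightarrow> real \<Rightarrow> real) \<Rightarrow> bool" where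
  "class_KL \<beta> \<longleftrightarrow>
     (\<forall>t\<ge>0. class_K (\<lambda>s. \<beta> s t)) \<and>
     (\<forall>s\<ge>0. continuous_on {0..} (\<beta> s) \<and> antimono_on {0..} (\<beta> s) \<and> (\<beta> s \<longlongrightarrow> 0) at_top)"

definition positive_definite_fun :: "(real \<Rightarrow> real) \<Rightarrow> bool" where
  "positive_definite_fun \<rho> \<longleftrightarrow> \<rho> 0 = 0 \<and> (\<forall>s>0. \<rho> s > 0)"

definition gain_fun :: "(real \<Rightarrow> real) \<Rightarrow> bool" where
  "gain_fun \<gamma> \<longleftrightarrow> continuous_on {0..} \<gamma> \<and> mono_on {0..} \<gamma> \<and> (\<forall>s\<ge>0. \<gamma> s \<ge> 0)"

subsection \<open>Continuously differentiable functions and gradients\<close>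

definition C1_fun :: "('a::real_inner \<Rightarrow> real) \<Rightarrow> bool" where
  "C1_fun V \<longleftrightarrow> (\<exists>g. (\<forall>x. GDERIV V x :> g x) \<and> continuous_on UNIV g)"

definition gradient :: "('a::real_inner \<Rightarrow> real) \<Rightarrow> 'a \<Rightarrow> 'a" where
  "gradient V x = (THE g. GDERIV V x :> g)"

subsection \<open>Inputs\<close>

definition loc_ess_bounded_input ::
    "(real ^ 'm) set \<Rightarrow> (real \<Rightarrow> real ^ 'm) \<Rightarrow> bool" where
  "loc_ess_bounded_input D d \<longleftrightarrow>
     (\<forall>t\<ge>0. d t \<in> D) \<and> d \<in> borel_measurable (lebesgue_on {0..}) \<and>
     (\<forall>T\<ge>0. \<exists>C. AE t in lebesgue_on {0..T}. norm (d t) \<le> C)"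

definition Linf_input ::
    "(real ^ 'm) set \<Rightarrow> (real \<Rightarrow> real ^ 'm) \<Rightarrow> bool" where
  "Linf_input D d \<longleftrightarrow>
     (\<forall>t\<ge>0. d t \<in> D) \<and> d \<in> borel_measurable (lebesgue_on {0..}) \<and>
     (\<exists>C. AE t in lebesgue_on {0..}. norm (d t) \<le> C)"

definition Linf_norm :: "(real \<Rightarrow> real ^ 'm) \<Rightarrow> real" where
  "Linf_norm d = real_of_ereal (esssup (lebesgue_on {0..}) (\<lambda>t. ereal (norm (d t))))"

subsection \<open>Solutions\<close>

text \<open>
  Caratheodory solutions on the whole half-line: locally absolutely continuous functions solving
  the differential equation almost everywhere, in the equivalent integral form (with a Lebesgue
  integral).
\<close>

definition is_solution ::
    "(real ^ 'n \<Rightarrow> real ^ 'm \<Rightarrow> real ^ 'n) \<Rightarrow> real ^ 'n \<Rightarrow> (real \<Rightarrow> real ^ 'm)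
      \<Rightarrow> (real \<Rightarrow> real ^ 'n) \<Rightarrow> bool" where
  "is_solution f x0 d \<phi> \<longleftrightarrow>
     (\<forall>t\<ge>0. (\<lambda>s. f (\<phi> s) (d s)) absolutely_integrable_on {0..t} \<and>
            \<phi> t = x0 + integral {0..t} (\<lambda>s. f (\<phi> s) (d s)))"

text \<open>
  Uniqueness is not part of the definition: it is a consequence of the Lipschitz condition below.
\<close>

definition forward_complete ::
    "(real ^ 'm) set \<Rightarrow> (real ^ 'n \<Rightarrow> real ^ 'm \<Rightarrow> real ^ 'n) \<Rightarrow> bool" where
  "forward_complete D f \<longleftrightarrow>
     (\<forall>x0 d. loc_ess_bounded_input D d \<longrightarrow> (\<exists>\<phi>. is_solution f x0 d \<phi>))"

definition loc_Lipschitz_in_state ::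
    "(real ^ 'm) set \<Rightarrow> (real ^ 'n \<Rightarrow> real ^ 'm \<Rightarrow> real ^ 'n) \<Rightarrow> bool" where
  "loc_Lipschitz_in_state D f \<longleftrightarrow>
     (\<forall>S K. compact S \<and> compact K \<and> K \<subseteq> D \<longrightarrow>
        (\<exists>L>0. \<forall>x\<in>S. \<forall>z\<in>S. \<forall>d\<in>K. norm (f x d - f z d) \<le> L * norm (x - z)))"

text \<open>
  The choice in \<open>sol\<close> matters only for negative times, where a solution is unconstrained.
\<close>

definition sol ::
    "(real ^ 'n \<Rightarrow> real ^ 'm \<Rightarrow> real ^ 'n) \<Rightarrow> real \<Rightarrow> real ^ 'n \<Rightarrow> (real \<Rightarrow> real ^ 'm)
      \<Rightarrow> real ^ 'n" where
  "sol f t x0 d = (SOME \<phi>. is_solution f x0 d \<phi>) t"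

definition sys_output ::
    "(real ^ 'n \<Rightarrow> real ^ 'm \<Rightarrow> real ^ 'n) \<Rightarrow> (real ^ 'n \<Rightarrow> real ^ 'k)
      \<Rightarrow> real \<Rightarrow> real ^ 'n \<Rightarrow> (real \<Rightarrow> real ^ 'm) \<Rightarrow> real ^ 'k" where
  "sys_output f h t x0 d = h (sol f t x0 d)"

subsection \<open>Input-to-output stability\<close>

definition p_IOS ::
    "(real ^ 'm) set \<Rightarrow> (real ^ 'n \<Rightarrow> real ^ 'm \<Rightarrow> real ^ 'n) \<Rightarrow> (real ^ 'n \<Rightarrow> real ^ 'k)
      \<Rightarrow> (real \<Rightarrow> real) \<Rightarrow> bool" where
  "p_IOS D f h \<gamma> \<longleftrightarrow> gain_fun \<gamma> \<and>
     (\<exists>\<beta>. class_KL \<beta> \<and>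
        (\<forall>x0 d. Linf_input D d \<longrightarrow>
           (\<forall>t\<ge>0. norm (sys_output f h t x0 d) \<le> \<beta> (norm x0) t + \<gamma> (Linf_norm d))))"

definition IOS ::
    "(real ^ 'm) set \<Rightarrow> (real ^ 'n \<Rightarrow> real ^ 'm \<Rightarrow> real ^ 'n) \<Rightarrow> (real ^ 'n \<Rightarrow> real ^ 'k)
      \<Rightarrow> bool" where
  "IOS D f h \<longleftrightarrow> (\<exists>\<gamma>. p_IOS D f h \<gamma> \<and> \<gamma> 0 = 0)"

end

theory Submission
  imports Defs
begin

text \<open>
  Put \<open>c = chi (Linf_norm d)\<close>. Since \<open>W\<close> does not increase where \<open>W \<ge> c\<close>, the sublevel set
  \<open>W \<le> c\<close> is forward invariant. Hence, if \<open>w = W (\<phi> t) > c\<close>, then \<open>W (\<phi> r)\<close> lies between \<open>w\<close> and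
  \<open>W x0\<close> for all \<open>r\<close> in \<open>[0, t]\<close>, and the decrease of \<open>V\<close> yields
  \<open>t * min {\<rho> r | w \<le> r \<le> W x0} \<le> V x0\<close>. The minimum is at least \<open>\<omega> w / E (W x0)\<close> for suitable
  continuous non-decreasing \<open>\<omega>\<close> and \<open>E\<close>. Multiplying the resulting bound on \<open>\<omega> w * (1 + t)\<close> by
  \<open>w \<le> W x0\<close>, which makes the right-hand side vanish at \<open>x0 = 0\<close> even if \<open>V 0 > 0\<close>, gives
  \<open>w * \<omega> w \<le> T (norm x0) / (1 + t)\<close>, so that an explicit class KL bound is obtained by inverting
  \<open>w \<mapsto> w * \<omega> w\<close>.
\<close>

section \<open>Running maxima over balls\<close>

text \<open>The maximum of \<open>u\<close> over the ball of radius \<open>s\<close> serves as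
  \<open>U s\<close>. It turns bounds that depend on the state into continuous non-decreasing bounds
  in its norm. That the maximum is attained gives monotonicity here and strict positivity of the
  minimum of \<open>\<rho>\<close> later.\<close>

lemma running_max:
  fixes u :: "'a::euclidean_space \<Rightarrow> real"
  assumes u: "continuous_on UNIV u"
  obtains U where "continuous_on {0..} U" "mono_on {0..} U" "U 0 = u 0"
    "\<And>x. u x \<le> U (norm x)" "\<And>s. s \<ge> 0 \<Longrightarrow> \<exists>x. norm x \<le> s \<and> U s = u x"
proof -
  \<comment> \<open>Scaling to the unit ball makes the index set independent of \<open>s\<close>, so
    continuity in \<open>s\<close> reduces to uniformity over one compact set.\<close>
  define U where "U s = (SUP z\<in>cball 0 1. u (s *\<^sub>R z))" for s
  have att: "\<exists>z\<in>cball 0 1. U s = u (s *\<^sub>R z) \<and> (\<forall>y\<in>cball 0 1. u (s *\<^sub>R y) \<le> U s)" for s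
  proof -
    have "continuous_on (cball 0 1) (\<lambda>z. u (s *\<^sub>R z))"
      by (intro continuous_on_compose2[OF u] continuous_intros) auto
    then obtain z where z: "z \<in> cball 0 1" "\<forall>y\<in>cball 0 1. u (s *\<^sub>R y) \<le> u (s *\<^sub>R z)"
      using continuous_attains_sup[OF compact_cball, of "0::'a" 1 "\<lambda>z. u (s *\<^sub>R z)"] by auto
    have "U s = u (s *\<^sub>R z)"
      unfolding U_def by (rule cSup_eq_maximum) (use z in auto)
    with z show ?thesis by auto
  qed
  have ub: "u x \<le> U s" if "norm x \<le> s" for x s
  proof (cases "s = 0")
    case True
    then show ?thesis using that att[of 0] by auto
  next
    case False
    then have "s > 0" using that norm_ge_zero[of x] by linarith
    then have "x /\<^sub>R s \<in> cball 0 1" using that by (simp add: field_simps)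
    then show ?thesis using att[of s] \<open>s > 0\<close> by fastforce
  qed
  have ex: "\<exists>x. norm x \<le> s \<and> U s = u x" if "s \<ge> 0" for s
  proof -
    obtain z where "z \<in> cball 0 1" "U s = u (s *\<^sub>R z)" using att by blast
    then show ?thesis using that by (intro exI[of _ "s *\<^sub>R z"]) (auto simp: mult_left_le)
  qed
  show ?thesis
  proof
    have cont2: "continuous_on (UNIV \<times> cball 0 1) (\<lambda>(s, z::'a). u (s *\<^sub>R z))"
      unfolding split_def by (intro continuous_on_compose2[OF u] continuous_intros) auto
    have "\<exists>d>0. \<forall>s. dist s s0 < d \<longrightarrow> dist (U s) (U s0) \<le> e" if e: "e > 0" for e s0
    proof -
      obtain X where X: "s0 \<in> X" "open X"
        "\<And>s z. s \<in> X \<Longrightarrow> z \<in> cball 0 1 \<Longrightarrow> dist (u (s *\<^sub>R z)) (u (s0 *\<^sub>R z)) \<le> e"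
        by (rule continuous_on_prod_compactE[OF cont2 compact_cball UNIV_I e, of s0])
          (metis Int_UNIV_right split_conv)
      obtain d where d: "d > 0" "\<And>s. dist s s0 < d \<Longrightarrow> s \<in> X"
        using X(1,2) by (auto simp: open_dist)
      have "dist (U s) (U s0) \<le> e" if "dist s s0 < d" for s
      proof -
        \<comment> \<open>A maximiser for one parameter is a competitor for the other, so uniform
          closeness of the functions passes to their maxima in both directions.\<close>
        obtain z z0 where z: "z \<in> cball 0 1" "U s = u (s *\<^sub>R z)" "u (s *\<^sub>R z0) \<le> U s"
          and z0: "z0 \<in> cball 0 1" "U s0 = u (s0 *\<^sub>R z0)" "u (s0 *\<^sub>R z) \<le> U s0"
          using att[of s] att[of s0] by blast
        show ?thesis
          using X(3)[OF d(2)[OF that] z(1)] X(3)[OF d(2)[OF that] z0(1)] z z0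
          by (auto simp: dist_real_def abs_if split: if_splits)
      qed
      with d show ?thesis by blast
    qed
    note near = this
    have "continuous_on UNIV U"
      unfolding continuous_on_iff
    proof (intro ballI allI impI)
      fix s0 e :: real assume "e > 0"
      then show "\<exists>d>0. \<forall>s\<in>UNIV. dist s s0 < d \<longrightarrow> dist (U s) (U s0) < e"
        using near[of "e / 2" s0] by fastforce
    qed
    then show "continuous_on {0..} U" by (rule continuous_on_subset) auto
    show "mono_on {0..} U"
      using ex ub by (intro mono_onI) (metis atLeast_iff order_trans)
    show "U 0 = u 0" using ex[of 0] by auto
    show "u x \<le> U (norm x)" for x by (rule ub) simp
    show "\<exists>x. norm x \<le> s \<and> U s = u x" if "s \<ge> 0" for s by (rule ex[OF that])
  qed
qed

section \<open>Decrease of a function along an absolutely continuous curve\<close>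

text \<open>
  The chain rule for absolutely continuous curves is avoided: up to \<open>e * I s t\<close> the estimate holds
  on short intervals and is additive over adjacent ones, so \<open>Bolzano\<close> extends it to \<open>[a, b]\<close>.
\<close>

lemma GDERIV_along_curve_le:
  fixes \<phi> g :: "real \<Rightarrow> 'a::euclidean_space"
  assumes "a \<le> b" and g: "g absolutely_integrable_on {a..b}"
    and \<phi>: "\<And>s t. a \<le> s \<Longrightarrow> s \<le> t \<Longrightarrow> t \<le> b \<Longrightarrow> \<phi> t - \<phi> s = integral {s..t} g"
    and V: "\<And>x. GDERIV V x :> G x" "continuous_on UNIV G"
    and N: "negligible N"
    and le: "\<And>s. s \<in> {a..b} - N \<Longrightarrow> G (\<phi> s) \<bullet> g s \<le> - \<kappa>"
  shows "V (\<phi> b) - V (\<phi> a) \<le> - \<kappa> * (b - a)"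
proof -
  have int: "g integrable_on {s..t}" "(\<lambda>x. norm (g x)) integrable_on {s..t}"
    if "a \<le> s" "t \<le> b" for s t
    using absolutely_integrable_on_subinterval[OF g, of s t] that
    by (auto simp: absolutely_integrable_on_def)
  have cont: "continuous_on {a..b} \<phi>"
  proof (rule continuous_on_eq)
    show "continuous_on {a..b} (\<lambda>t. \<phi> a + integral {a..t} g)"
      by (intro continuous_intros indefinite_integral_continuous_1 int) auto
    show "\<phi> a + integral {a..t} g = \<phi> t" if "t \<in> {a..b}" for t
      using \<phi>[of a t] that by (auto simp: algebra_simps)
  qed
  define I where "I s t = integral {s..t} (\<lambda>x. norm (g x))" for s t
  have main: "V (\<phi> b) - V (\<phi> a) \<le> - \<kappa> * (b - a) + e * I a b" if e: "e > 0" for e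
  proof -
    define P where "P s t \<longleftrightarrow> (a \<le> s \<longrightarrow> t \<le> b \<longrightarrow>
      V (\<phi> t) - V (\<phi> s) \<le> - \<kappa> * (t - s) + e * I s t)" for s t
    have "P a b" using \<open>a \<le> b\<close>
    proof (induction rule: Bolzano)
      case (trans p q r)
      show ?case unfolding P_def
      proof (intro impI)
        assume ar: "a \<le> p" "r \<le> b"
        have "I p q + I q r = I p r"
          unfolding I_def by (rule Henstock_Kurzweil_Integration.integral_combine)
            (use trans ar int in auto)
        then have "e * I p r = e * I p q + e * I q r" by (metis distrib_left)
        then show "V (\<phi> r) - V (\<phi> p) \<le> - \<kappa> * (r - p) + e * I p r"
          using trans ar by (simp add: P_def algebra_simps)
      qed
    next
      case (local x)
      obtain d1 where d1: "d1 > 0" "\<And>z. dist z (\<phi> x) < d1 \<Longrightarrow> dist (G z) (G (\<phi> x)) < e / 2"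
        using V(2) e unfolding continuous_on_iff by (metis UNIV_I half_gt_zero)
      obtain d2 where d2: "d2 > 0"
        "\<And>s. s \<in> {a..b} \<Longrightarrow> dist s x < d2 \<Longrightarrow> dist (\<phi> s) (\<phi> x) < d1"
        using cont local d1(1) unfolding continuous_on_iff by (metis atLeastAtMost_iff)
      show ?case
      proof (intro exI[of _ d2] conjI allI impI)
        fix s t assume st: "s \<le> x \<and> x \<le> t \<and> t - s < d2"
        show "P s t" unfolding P_def
        proof (intro impI)
          assume as: "a \<le> s" "t \<le> b"
          \<comment> \<open>The gradient is frozen at \<open>\<phi> x\<close>. Near that point
            \<open>V z - p \<bullet> z\<close> has gradient at most \<open>e / 2\<close> in norm,
            and the linear part is integrated exactly; each contributes an error of
            \<open>e / 2 * I s t\<close>.\<close>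
          define p where "p = G (\<phi> x)"
          have near: "\<phi> r \<in> ball (\<phi> x) d1" if "r \<in> {s..t}" for r
            using d2(2)[of r] that st as by (auto simp: dist_commute dist_real_def)
          have "norm ((V (\<phi> t) - p \<bullet> \<phi> t) - (V (\<phi> s) - p \<bullet> \<phi> s)) \<le> e / 2 * norm (\<phi> t - \<phi> s)"
          proof (rule differentiable_bound[of "ball (\<phi> x) d1" _ "\<lambda>z h. h \<bullet> (G z - p)"])
            fix z assume z: "z \<in> ball (\<phi> x) d1"
            have "((\<lambda>z. V z - p \<bullet> z) has_derivative (\<lambda>h. h \<bullet> G z - p \<bullet> h)) (at z)"
              using V(1)[of z] unfolding gderiv_def by (auto intro!: derivative_eq_intros)
            then show "((\<lambda>z. V z - p \<bullet> z) has_derivative (\<lambda>h. h \<bullet> (G z - p)))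
                (at z within ball (\<phi> x) d1)"
              by (auto simp: inner_diff_right inner_commute intro: has_derivative_at_withinI)
            have "norm (G z - p) \<le> e / 2"
              using d1(2)[of z] z by (simp add: p_def dist_commute dist_norm)
            then have "\<bar>h \<bullet> (G z - p)\<bar> \<le> e / 2 * norm h" for h
              using Cauchy_Schwarz_ineq2[of h "G z - p"]
                mult_right_mono[of "norm (G z - p)" "e / 2" "norm h"]
              by (simp add: mult.commute)
            then show "onorm (\<lambda>h. h \<bullet> (G z - p)) \<le> e / 2"
              by (intro onorm_bound) (use e in auto)
          qed (use near st in auto)
          moreover have "norm (\<phi> t - \<phi> s) \<le> I s t"
            unfolding I_def using \<phi>[of s t] st as int[of s t]
            by (auto intro!: Henstock_Kurzweil_Integration.integral_norm_bound_integral)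
          then have "e / 2 * norm (\<phi> t - \<phi> s) \<le> e / 2 * I s t"
            using e by simp
          moreover have "p \<bullet> (\<phi> t - \<phi> s) \<le> - \<kappa> * (t - s) + e / 2 * I s t"
          proof -
            have "((\<lambda>r. p \<bullet> g r) has_integral p \<bullet> (\<phi> t - \<phi> s)) {s..t}"
              using has_integral_linear[OF integrable_integral[OF int(1)[OF as]]
                  bounded_linear_inner_right[of p]] \<phi>[of s t] st as
              by (simp add: o_def)
            \<comment> \<open>On the null set \<open>N\<close> the integrand is replaced by the
              intended upper bound, so that the comparison of integrands holds at every
              point.\<close>
            then have 1: "((\<lambda>r. if r \<in> N then - \<kappa> + e / 2 * norm (g r) else p \<bullet> g r)
                has_integral p \<bullet> (\<phi> t - \<phi> s)) {s..t}"
              by (rule has_integral_spike[OF N, rotated]) auto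
            have 2: "((\<lambda>r. - \<kappa> + e / 2 * norm (g r)) has_integral - \<kappa> * (t - s) + e / 2 * I s t) {s..t}"
              unfolding I_def
              using has_integral_add[OF has_integral_const_real[of "- \<kappa>" s t]
                  has_integral_mult_right[OF integrable_integral[OF int(2)[OF as]], of "e/2"]] st
              by (simp add: mult.commute)
            show ?thesis
            proof (rule has_integral_le[OF 1 2])
              fix r assume r: "r \<in> {s..t}"
              have "p \<bullet> g r \<le> - \<kappa> + e / 2 * norm (g r)" if "r \<notin> N"
              proof -
                have "(p - G (\<phi> r)) \<bullet> g r \<le> norm (p - G (\<phi> r)) * norm (g r)"
                  by (rule norm_cauchy_schwarz)
                also have "\<dots> \<le> e / 2 * norm (g r)"
                  using d1(2)[of "\<phi> r"] near[OF r]
                  by (intro mult_right_mono) (auto simp: p_def dist_norm norm_minus_commute)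
                finally show ?thesis
                  using le[of r] that r as by (auto simp: inner_diff_left)
              qed
              then show "(if r \<in> N then - \<kappa> + e / 2 * norm (g r) else p \<bullet> g r)
                  \<le> - \<kappa> + e / 2 * norm (g r)" by auto
            qed
          qed
          ultimately show "V (\<phi> t) - V (\<phi> s) \<le> - \<kappa> * (t - s) + e * I s t"
            unfolding inner_diff_right real_norm_def by argo
        qed
      qed (rule d2(1))
    qed
    then show ?thesis by (simp add: P_def)
  qed
  have "I a b \<ge> 0" unfolding I_def
    by (intro Henstock_Kurzweil_Integration.integral_nonneg int) auto
  show ?thesis
  proof (rule field_le_epsilon)
    fix e :: real assume "e > 0"
    \<comment> \<open>The summand 1 covers the case \<open>I a b = 0\<close>.\<close>
    have "e / (I a b + 1) * I a b \<le> e"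
      using \<open>e > 0\<close> \<open>I a b \<ge> 0\<close> by (simp add: field_simps)
    then show "V (\<phi> b) - V (\<phi> a) \<le> - \<kappa> * (b - a) + e"
      using main[of "e / (I a b + 1)"] \<open>e > 0\<close> \<open>I a b \<ge> 0\<close> by auto
  qed
qed

section \<open>Inverses of class K-infinity functions\<close>

text \<open>Strict monotonicity gives injectivity, and unboundedness with the intermediate value
  theorem gives surjectivity onto \<open>{0..}\<close>. A continuous bijection between intervals is
  a homeomorphism, whence continuity of the inverse.\<close>

lemma class_K_inf_inverse:
  assumes "class_K_inf a"
  shows "class_K (inv_into {0..} a)"
    and "\<And>y. y \<ge> 0 \<Longrightarrow> a (inv_into {0..} a y) = y"
    and "\<And>x. x \<ge> 0 \<Longrightarrow> inv_into {0..} a (a x) = x"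
    and "\<And>y. y \<ge> 0 \<Longrightarrow> inv_into {0..} a y \<ge> 0"
proof -
  have a: "continuous_on {0..} a" "strict_mono_on {0..} a" "a 0 = 0" "filterlim a at_top at_top"
    using assms by (auto simp: class_K_inf_def class_K_def)
  have inj: "inj_on a {0..}" by (rule strict_mono_on_imp_inj_on[OF a(2)])
  have img: "a ` {0..} = {0..}"
  proof (intro equalityI subsetI)
    fix y assume "y \<in> a ` {0..}"
    then show "y \<in> {0..}"
      using strict_mono_on_leD[OF a(2), of 0] a(3) by fastforce
  next
    fix y :: real assume y: "y \<in> {0..}"
    obtain c where c: "\<And>x. x \<ge> c \<Longrightarrow> a x \<ge> y"
      using a(4) unfolding filterlim_at_top eventually_at_top_linorder by blast
    have "\<exists>x. 0 \<le> x \<and> x \<le> max 0 c \<and> a x = y"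
      by (rule IVT') (use y c a(3) continuous_on_subset[OF a(1)] in auto)
    then show "y \<in> a ` {0..}" by force
  qed
  show inv: "\<And>y. y \<ge> 0 \<Longrightarrow> a (inv_into {0..} a y) = y"
    using img by (metis atLeast_iff f_inv_into_f)
  show left: "\<And>x. x \<ge> 0 \<Longrightarrow> inv_into {0..} a (a x) = x"
    using inj by (simp add: inv_into_f_f)
  show nn: "\<And>y. y \<ge> 0 \<Longrightarrow> inv_into {0..} a y \<ge> 0"
    using img by (metis atLeast_iff inv_into_into)
  obtain g where g: "homeomorphism {0..} {0..} a g"
    using homeomorphism_into_1d[OF _ a(1) img inj] by (auto simp: convex_imp_path_connected)
  have "g y = inv_into {0..} a y" if "y \<ge> 0" for y
    using g that left inv[OF that] nn[OF that] by (metis atLeast_iff homeomorphism_apply1)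
  then have "continuous_on {0..} (inv_into {0..} a)"
    using homeomorphism_cont2[OF g] by (metis (mono_tags, lifting) atLeast_iff continuous_on_cong)
  moreover have "strict_mono_on {0..} (inv_into {0..} a)"
  proof (rule strict_mono_onI)
    fix x y :: real assume "x \<in> {0..}" "y \<in> {0..}" "x < y"
    then show "inv_into {0..} a x < inv_into {0..} a y"
      using strict_mono_on_leD[OF a(2), of "inv_into {0..} a y" "inv_into {0..} a x"] inv nn
      by (metis atLeast_iff linorder_not_less)
  qed
  moreover have "inv_into {0..} a 0 = 0" using left[of 0] a(3) by simp
  ultimately show "class_K (inv_into {0..} a)" by (simp add: class_K_def)
qed

section \<open>Gradients and essentially bounded inputs\<close>

lemma GDERIV_gradient:
  assumes "GDERIV V x :> g"
  shows "gradient V x = g"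
  unfolding gradient_def
proof (rule the_equality)
  fix g' assume "GDERIV V x :> g'"
  then have "(\<lambda>h. h \<bullet> g') = (\<lambda>h. h \<bullet> g)"
    using assms unfolding gderiv_def by (rule has_derivative_unique)
  then have "\<forall>h. h \<bullet> g' = h \<bullet> g" by (auto dest: fun_cong)
  then show "g' = g" by (simp only: vector_eq_ldot)
qed (rule assms)

lemma C1_fun_gradient:
  assumes "C1_fun V"
  shows "GDERIV V x :> gradient V x" "continuous_on UNIV (gradient V)" "continuous_on UNIV V"
proof -
  obtain g where g: "\<And>x. GDERIV V x :> g x" "continuous_on UNIV g"
    using assms unfolding C1_fun_def by auto
  then have "gradient V = g" using GDERIV_gradient by blast
  with g show "GDERIV V x :> gradient V x" "continuous_on UNIV (gradient V)" by auto
  show "continuous_on UNIV V"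
    using g(1) unfolding gderiv_def
    by (meson continuous_at_imp_continuous_on has_derivative_continuous)
qed

lemma Linf_input_imp_loc_ess_bounded:
  assumes "Linf_input D d"
  shows "loc_ess_bounded_input D d"
proof -
  obtain C where C: "AE t in lebesgue_on {0..}. norm (d t) \<le> C"
    using assms unfolding Linf_input_def by auto
  have "AE t in lebesgue_on {0..T}. norm (d t) \<le> C" for T
    using C by (auto simp: AE_restrict_space_iff elim!: eventually_mono)
  then show ?thesis using assms unfolding Linf_input_def loc_ess_bounded_input_def by blast
qed

text \<open>The essential supremum is finite and nonnegative, so \<open>real_of_ereal\<close> loses
  nothing in \<open>Linf_norm\<close>. The almost everywhere bound is restated with a negligible
  exceptional set, the form required by the estimates along curves.\<close>

lemma Linf_norm_bound:
  assumes "Linf_input D d"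
  obtains N where "negligible N" "\<And>t. t \<ge> 0 \<Longrightarrow> t \<notin> N \<Longrightarrow> norm (d t) \<le> Linf_norm d"
    "Linf_norm d \<ge> 0"
proof -
  let ?M = "lebesgue_on {0::real..}"
  let ?e = "esssup ?M (\<lambda>t. ereal (norm (d t)))"
  obtain C where C: "AE t in ?M. norm (d t) \<le> C" and [measurable]: "d \<in> borel_measurable ?M"
    using assms unfolding Linf_input_def by auto
  have "?e \<le> ereal C" by (rule esssup_I) (use C in auto)
  \<comment> \<open>\<open>esssup_const\<close> requires a space of nonzero measure; over a null
    space the essential supremum would be minus infinity.\<close>
  moreover have "emeasure ?M (space ?M) \<noteq> 0"
  proof
    assume "emeasure ?M (space ?M) = 0"
    then have "emeasure lebesgue {0::real..} = 0"
      by (simp add: emeasure_restrict_space)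
    then have "negligible {0::real..}" by (simp add: negligible_iff_null_sets null_sets_def)
    then have "negligible {0..1::real}" by (rule negligible_subset) auto
    then show False using negligible_interval(1)[of 0 "1::real"] by simp
  qed
  then have "esssup ?M (\<lambda>_. 0::ereal) = 0" by (simp add: esssup_const)
  then have "0 \<le> ?e"
    using esssup_mono[of "\<lambda>_. 0::ereal" ?M "\<lambda>t. ereal (norm (d t))"] by simp
  ultimately have fin: "?e = ereal (Linf_norm d)" "Linf_norm d \<ge> 0"
    unfolding Linf_norm_def by (cases ?e; simp)+
  have "AE t in ?M. norm (d t) \<le> Linf_norm d"
    using esssup_AE[of "\<lambda>t. ereal (norm (d t))" ?M] unfolding fin by simp
  then have "AE t in lebesgue. t \<ge> 0 \<longrightarrow> norm (d t) \<le> Linf_norm d"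
    by (subst (asm) AE_restrict_space_iff) auto
  then obtain N where "N \<in> null_sets lebesgue"
    "{t \<in> space lebesgue. \<not> (t \<ge> 0 \<longrightarrow> norm (d t) \<le> Linf_norm d)} \<subseteq> N"
    unfolding eventually_ae_filter by auto
  with fin show ?thesis by (intro that[of N]) (auto simp: negligible_iff_null_sets)
qed

section \<open>A monotone lower bound for the decay rate\<close>

text \<open>\<open>\<omega> w\<close> is the minimum of \<open>\<rho>\<close> over
  \<open>[w, 1]\<close>, and \<open>\<rho> 1\<close> for \<open>w \<ge> 1\<close>;
  \<open>E n\<close> is the maximum of \<open>1 + \<rho> 1 / \<rho> r\<close> over
  \<open>1 \<le> r \<le> 1 + n\<close>. For \<open>r \<le> 1\<close> already
  \<open>\<omega> w \<le> \<rho> r\<close>; for larger \<open>r\<close>,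
  \<open>\<omega> w \<le> \<rho> 1\<close> and \<open>E n\<close> compensates for the ratio
  \<open>\<rho> 1 / \<rho> r\<close>.\<close>

lemma positive_definite_lower_factorization:
  assumes \<rho>: "continuous_on {0..} \<rho>" "positive_definite_fun \<rho>"
  obtains \<omega> E where "continuous_on {0..} \<omega>" "mono_on {0..} \<omega>"
    "\<And>w. w \<ge> 0 \<Longrightarrow> \<omega> w \<ge> 0" "\<And>w. w > 0 \<Longrightarrow> \<omega> w > 0"
    "continuous_on {0..} E" "mono_on {0..} E" "\<And>n. n \<ge> 0 \<Longrightarrow> E n \<ge> 1"
    "\<And>w r n. 0 \<le> w \<Longrightarrow> w \<le> r \<Longrightarrow> r \<le> n \<Longrightarrow> \<omega> w \<le> \<rho> r * E n"
proof -
  have pos: "\<rho> r > 0" if "r > 0" for r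
    using \<rho>(2) that by (auto simp: positive_definite_fun_def)
  have nn: "\<rho> r \<ge> 0" if "r \<ge> 0" for r
    using \<rho>(2) that by (cases "r = 0") (auto simp: positive_definite_fun_def less_le)
  \<comment> \<open>Sign and reflection \<open>1 - norm x\<close> turn a minimum over
    \<open>[w, 1]\<close> into a running maximum of radius \<open>1 - w\<close>.\<close>
  have "continuous_on UNIV (\<lambda>x::real. - \<rho> (max 0 (1 - norm x)))"
    by (intro continuous_intros continuous_on_compose2[OF \<rho>(1)]) auto
  then obtain U where U: "continuous_on {0..} U" "mono_on {0..} U" "U 0 = - \<rho> (max 0 (1 - norm (0::real)))"
    "\<And>x. - \<rho> (max 0 (1 - norm x)) \<le> U (norm (x::real))"
    "\<And>s. s \<ge> 0 \<Longrightarrow> \<exists>x::real. norm x \<le> s \<and> U s = - \<rho> (max 0 (1 - norm x))"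
    by (rule running_max) blast
  \<comment> \<open>The shift by 1 keeps the argument of \<open>\<rho>\<close> away from its zero at
    0.\<close>
  have "continuous_on UNIV (\<lambda>x::real. 1 + \<rho> 1 / \<rho> (1 + norm x))"
    by (intro continuous_intros continuous_on_compose2[OF \<rho>(1)])
      (auto intro!: less_imp_neq[OF pos, symmetric] add_pos_nonneg)
  then obtain E where E: "continuous_on {0..} E" "mono_on {0..} E" "E 0 = 1 + \<rho> 1 / \<rho> (1 + norm (0::real))"
    "\<And>x. 1 + \<rho> 1 / \<rho> (1 + norm x) \<le> E (norm (x::real))"
    by (rule running_max) blast
  define \<omega> where "\<omega> w = - U (max 0 (1 - w))" for w
  have E1: "E n \<ge> 1" if "n \<ge> 0" for n
    using mono_onD[OF E(2), of 0 n] E(3) pos[of 1] that by auto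
  show ?thesis
  proof
    show "continuous_on {0..} \<omega>" unfolding \<omega>_def
      by (intro continuous_intros continuous_on_compose2[OF U(1)]) auto
    show "mono_on {0..} \<omega>" unfolding \<omega>_def
      by (intro mono_onI) (auto intro!: mono_onD[OF U(2)])
    show "\<omega> w \<ge> 0" if "w \<ge> 0" for w
      using U(5)[of "max 0 (1 - w)"] nn unfolding \<omega>_def by force
    show "\<omega> w > 0" if "w > 0" for w
    proof -
      obtain x :: real where "norm x \<le> max 0 (1 - w)" "U (max 0 (1 - w)) = - \<rho> (max 0 (1 - norm x))"
        using U(5)[OF max.cobounded1] by blast
      \<comment> \<open>The minimum is attained at a point not below \<open>min w 1\<close>, hence
        at a positive one.\<close>
      moreover from this(1) have "max 0 (1 - norm x) > 0" using that by auto
      ultimately show ?thesis unfolding \<omega>_def using pos by simp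
    qed
    show "\<omega> w \<le> \<rho> r * E n" if wrn: "0 \<le> w" "w \<le> r" "r \<le> n" for w r n
    proof (cases "r \<le> 1")
      case True
      have "- \<rho> r \<le> U (1 - r)" using U(4)[of "1 - r"] True wrn by (auto simp: max_def)
      also have "\<dots> \<le> U (max 0 (1 - w))" by (rule mono_onD[OF U(2)]) (use True wrn in auto)
      finally have "\<omega> w \<le> \<rho> r" by (simp add: \<omega>_def)
      also have "\<dots> \<le> \<rho> r * E n"
        using E1[of n] nn[of r] wrn by (simp add: mult_le_cancel_left1)
      finally show ?thesis .
    next
      case False
      have "\<omega> w \<le> \<rho> 1"
        using mono_onD[OF U(2), of 0 "max 0 (1 - w)"] U(3) by (simp add: \<omega>_def)
      have "1 + \<rho> 1 / \<rho> r \<le> E (r - 1)" using E(4)[of "r - 1"] False by simp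
      also have "\<dots> \<le> E n" by (rule mono_onD[OF E(2)]) (use False wrn in auto)
      finally have "\<rho> 1 / \<rho> r \<le> E n" by simp
      then have "\<rho> 1 \<le> \<rho> r * E n"
        using pos[of r] False by (simp add: divide_le_eq mult.commute)
      with \<open>\<omega> w \<le> \<rho> 1\<close> show ?thesis by simp
    qed
  qed (use E E1 in auto)
qed

section \<open>Lyapunov functions along solutions\<close>

lemma is_solution_integrable:
  assumes "is_solution f x0 d \<phi>" "0 \<le> s"
  shows "(\<lambda>r. f (\<phi> r) (d r)) absolutely_integrable_on {s..t}"
proof (cases "s \<le> t")
  case True
  with assms have "(\<lambda>r. f (\<phi> r) (d r)) absolutely_integrable_on {0..t}"
    by (simp add: is_solution_def)
  then show ?thesis by (rule absolutely_integrable_on_subinterval) (use assms in auto)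
qed auto

lemma is_solution_increment:
  assumes "is_solution f x0 d \<phi>" "0 \<le> s" "s \<le> t"
  shows "\<phi> t - \<phi> s = integral {s..t} (\<lambda>r. f (\<phi> r) (d r))"
proof -
  have "(\<lambda>r. f (\<phi> r) (d r)) integrable_on {0..t}"
    using is_solution_integrable[OF assms(1), of 0 t] by (simp add: absolutely_integrable_on_def)
  then have "integral {0..s} (\<lambda>r. f (\<phi> r) (d r)) + integral {s..t} (\<lambda>r. f (\<phi> r) (d r))
      = integral {0..t} (\<lambda>r. f (\<phi> r) (d r))"
    by (rule Henstock_Kurzweil_Integration.integral_combine[OF assms(2,3)])
  moreover have "\<phi> t = x0 + integral {0..t} (\<lambda>r. f (\<phi> r) (d r))"
    "\<phi> s = x0 + integral {0..s} (\<lambda>r. f (\<phi> r) (d r))"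
    using assms by (auto simp: is_solution_def)
  ultimately show ?thesis by (simp add: algebra_simps)
qed

lemma is_solution_continuous:
  assumes "is_solution f x0 d \<phi>" "0 \<le> s"
  shows "continuous_on {s..t} \<phi>"
proof (rule continuous_on_eq)
  show "continuous_on {s..t} (\<lambda>r. \<phi> s + integral {s..r} (\<lambda>r. f (\<phi> r) (d r)))"
    using is_solution_integrable[OF assms, of t]
    by (intro continuous_intros indefinite_integral_continuous_1)
      (simp add: absolutely_integrable_on_def)
  show "\<phi> s + integral {s..r} (\<lambda>r. f (\<phi> r) (d r)) = \<phi> r" if "r \<in> {s..t}" for r
    using is_solution_increment[OF assms, of r] that by (auto simp: algebra_simps)
qed

lemma Lyapunov_decrease_along_solution:
  assumes "is_solution f x0 d \<phi>" "C1_fun V" "0 \<le> s" "s \<le> t" "negligible N"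
    and "\<And>r. r \<in> {s..t} - N \<Longrightarrow> gradient V (\<phi> r) \<bullet> f (\<phi> r) (d r) \<le> - \<kappa>"
  shows "V (\<phi> t) - V (\<phi> s) \<le> - \<kappa> * (t - s)"
proof (rule GDERIV_along_curve_le[where \<phi> = \<phi> and g = "\<lambda>r. f (\<phi> r) (d r)" and G = "gradient V"])
  show "\<phi> r - \<phi> q = integral {q..r} (\<lambda>r. f (\<phi> r) (d r))" if "s \<le> q" "q \<le> r" for q r
    using is_solution_increment[OF assms(1), of q r] that assms(3) by simp
qed (use assms is_solution_integrable C1_fun_gradient[OF assms(2)] in blast)+

text \<open>Let \<open>q\<close> be the last time in \<open>[s, t]\<close> with
  \<open>W (\<phi> q) \<le> c\<close>. After \<open>q\<close> the value exceeds \<open>c\<close>, so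
  \<open>W\<close> does not increase on \<open>[q, t]\<close> and cannot have left the sublevel
  set.\<close>

lemma Lyapunov_sublevel_invariant:
  assumes sol: "is_solution f x0 d \<phi>" and W: "C1_fun W" and N: "negligible N"
    and dec: "\<And>r. r \<ge> 0 \<Longrightarrow> r \<notin> N \<Longrightarrow> W (\<phi> r) \<ge> c \<Longrightarrow> gradient W (\<phi> r) \<bullet> f (\<phi> r) (d r) \<le> 0"
    and s: "0 \<le> s" "s \<le> t" and low: "W (\<phi> s) \<le> c"
  shows "W (\<phi> t) \<le> c"
proof (rule ccontr)
  assume contra: "\<not> W (\<phi> t) \<le> c"
  let ?A = "{r \<in> {s..t}. W (\<phi> r) \<le> c}"
  have "continuous_on {s..t} (\<lambda>r. W (\<phi> r))"
    by (rule continuous_on_compose2[OF C1_fun_gradient(3)[OF W] is_solution_continuous[OF sol s(1)]])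
      auto
  then have "closed {r \<in> {s..t}. W (\<phi> r) \<le> c}"
    by (intro continuous_on_closed_Collect_le continuous_intros) auto
  moreover have "bounded ?A" by (rule bounded_subset[of "{s..t}"]) auto
  ultimately have "compact ?A" by (simp only: compact_eq_bounded_closed)
  moreover have "s \<in> ?A" using s low by auto
  ultimately obtain q where q: "q \<in> ?A" "\<And>r. r \<in> ?A \<Longrightarrow> r \<le> q"
    using compact_attains_sup[of ?A] by blast
  have "W (\<phi> t) - W (\<phi> q) \<le> - 0 * (t - q)"
  proof (rule Lyapunov_decrease_along_solution[OF sol W])
    \<comment> \<open>At \<open>q\<close> itself only \<open>W (\<phi> q) \<le> c\<close> is at
      hand, so this single time joins the exceptional set.\<close>
    show "negligible (insert q N)" using N by simp
    fix r assume r: "r \<in> {q..t} - insert q N"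
    have "W (\<phi> r) > c" using q(2)[of r] r q(1) by force
    then show "gradient W (\<phi> r) \<bullet> f (\<phi> r) (d r) \<le> - 0" using dec[of r] r q(1) s by auto
  qed (use q s in auto)
  then show False using q(1) contra by auto
qed

section \<open>Building the comparison functions\<close>

text \<open>The quotient is nonnegative, strictly increasing in \<open>s\<close>, and tends
  monotonically to 0 in \<open>t\<close>; applying the class K function \<open>A\<close> preserves
  all of this. The lemma is applied with the inverse of another function in the role of
  \<open>A\<close>.\<close>

lemma class_KL_inverse_quotient:
  assumes "class_K A" "continuous_on {0..} T" "strict_mono_on {0..} T" "T 0 = 0"
  shows "class_KL (\<lambda>s t. A (T s / (1 + t)))"
proof -
  have A: "continuous_on {0..} A" "strict_mono_on {0..} A" "A 0 = 0"
    using assms(1) by (auto simp: class_K_def)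
  have T0: "T s \<ge> 0" if "s \<ge> 0" for s
    using strict_mono_on_leD[OF assms(3), of 0 s] assms(4) that by simp
  show ?thesis
    unfolding class_KL_def class_K_def
  proof (intro conjI allI impI)
    fix t :: real assume t: "t \<ge> 0"
    show "continuous_on {0..} (\<lambda>s. A (T s / (1 + t)))"
    proof (rule continuous_on_compose2[OF A(1)])
      show "continuous_on {0..} (\<lambda>s. T s / (1 + t))"
        using t by (intro continuous_on_divide assms(2) continuous_on_const) auto
    qed (use t in \<open>auto intro!: divide_nonneg_nonneg T0\<close>)
    show "strict_mono_on {0..} (\<lambda>s. A (T s / (1 + t)))"
    proof (rule strict_mono_onI)
      fix r s :: real assume rs: "r \<in> {0..}" "s \<in> {0..}" "r < s"
      then have "T r < T s" by (rule strict_mono_onD[OF assms(3)])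
      then have "T r / (1 + t) < T s / (1 + t)" using t by (simp add: divide_strict_right_mono)
      then show "A (T r / (1 + t)) < A (T s / (1 + t))"
        using rs t T0[of r] T0[of s] by (intro strict_mono_onD[OF A(2)]) auto
    qed
    show "A (T 0 / (1 + t)) = 0" using assms(4) A(3) by simp
  next
    fix s :: real assume s: "s \<ge> 0"
    have quot: "T s / (1 + t) \<ge> 0" if "t \<ge> 0" for t using that T0[OF s] by simp
    show "continuous_on {0..} (\<lambda>t. A (T s / (1 + t)))"
    proof (rule continuous_on_compose2[OF A(1)])
      show "continuous_on {0..} (\<lambda>t. T s / (1 + t))"
        by (intro continuous_on_divide continuous_on_const continuous_on_add continuous_on_id) auto
    qed (auto intro!: quot)
    show "monotone_on {0..} (\<le>) (\<ge>) (\<lambda>t. A (T s / (1 + t)))"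
    proof (rule monotone_onI)
      fix q t :: real assume qt: "q \<in> {0..}" "t \<in> {0..}" "q \<le> t"
      then have "T s / (1 + t) \<le> T s / (1 + q)" using T0[OF s] by (intro divide_left_mono) auto
      then show "A (T s / (1 + q)) \<ge> A (T s / (1 + t))"
        using qt quot by (intro strict_mono_on_leD[OF A(2)]) auto
    qed
    have "((\<lambda>t. T s / (1 + t)) \<longlongrightarrow> 0) at_top"
      by (intro tendsto_divide_0[OF tendsto_const] filterlim_at_top_imp_at_infinity
          filterlim_tendsto_add_at_top[OF tendsto_const] filterlim_ident)
    then have "((\<lambda>t. A (T s / (1 + t))) \<longlongrightarrow> A 0) at_top"
    proof (rule continuous_on_tendsto_compose[OF A(1)])
      show "\<forall>\<^sub>F t in at_top. T s / (1 + t) \<in> {0..}"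
        using eventually_ge_at_top[of 0] by eventually_elim (simp add: quot)
    qed simp
    then show "((\<lambda>t. A (T s / (1 + t))) \<longlongrightarrow> 0) at_top" using A(3) by simp
  qed
qed

text \<open>Strictness comes from the factor \<open>a\<close> together with positivity of
  \<open>\<omega>\<close> at the larger argument. Once \<open>a x \<ge> 1\<close>, the product
  dominates \<open>\<omega> 1 * a x\<close>, which is unbounded.\<close>

lemma class_K_inf_times_mono:
  assumes a: "class_K_inf a"
    and \<omega>: "continuous_on {0..} \<omega>" "mono_on {0..} \<omega>" "\<And>w. w \<ge> 0 \<Longrightarrow> \<omega> w \<ge> 0" "\<And>w. w > 0 \<Longrightarrow> \<omega> w > 0"
  shows "class_K_inf (\<lambda>x. a x * \<omega> (a x))"
proof -
  have a: "continuous_on {0..} a" "strict_mono_on {0..} a" "a 0 = 0" "filterlim a at_top at_top"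
    using a by (auto simp: class_K_inf_def class_K_def)
  have a0: "a x \<ge> 0" if "x \<ge> 0" for x
    using strict_mono_on_leD[OF a(2), of 0 x] a(3) that by simp
  have "continuous_on {0..} (\<lambda>x. a x * \<omega> (a x))"
    by (intro continuous_intros a(1) continuous_on_compose2[OF \<omega>(1)]) (use a0 in auto)
  moreover have "strict_mono_on {0..} (\<lambda>x. a x * \<omega> (a x))"
  proof (rule strict_mono_onI)
    fix x y :: real assume xy: "x \<in> {0..}" "y \<in> {0..}" "x < y"
    then have "a x < a y" using strict_mono_onD[OF a(2)] by blast
    moreover have "0 \<le> a x" using a0 xy by simp
    ultimately have "a x * \<omega> (a x) \<le> a x * \<omega> (a y)" "a x * \<omega> (a y) < a y * \<omega> (a y)"
      using mono_onD[OF \<omega>(2), of "a x" "a y"] \<omega>(4)[of "a y"]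
      by (auto intro!: mult_left_mono mult_strict_right_mono)
    then show "a x * \<omega> (a x) < a y * \<omega> (a y)" by linarith
  qed
  moreover have "filterlim (\<lambda>x. a x * \<omega> (a x)) at_top at_top"
  proof (rule filterlim_at_top_mono)
    show "filterlim (\<lambda>x. \<omega> 1 * a x) at_top at_top"
      by (rule filterlim_tendsto_pos_mult_at_top[OF tendsto_const _ a(4)]) (use \<omega>(4) in auto)
    have "eventually (\<lambda>x. a x \<ge> 1) at_top" using a(4) by (simp add: filterlim_at_top)
    then show "eventually (\<lambda>x. \<omega> 1 * a x \<le> a x * \<omega> (a x)) at_top"
      by eventually_elim (use mono_onD[OF \<omega>(2), of 1] in \<open>auto simp: mult.commute\<close>)
  qed
  ultimately show ?thesis using a(3) by (simp add: class_K_inf_def class_K_def)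
qed

section \<open>The input-to-output estimate\<close>

theorem theorem3:
  fixes D :: "(real ^ 'm) set"
    and f :: "real ^ 'n \<Rightarrow> real ^ 'm \<Rightarrow> real ^ 'n"
    and h :: "real ^ 'n \<Rightarrow> real ^ 'k"
    and V W :: "real ^ 'n \<Rightarrow> real"
    and a chi \<rho> :: "real \<Rightarrow> real"
  assumes "closed D" and "0 \<in> D"
    and "continuous_on (UNIV \<times> D) (\<lambda>(x, d). f x d)" and "f 0 0 = 0"
    and "loc_Lipschitz_in_state D f"
    and "continuous_on UNIV h" and "h 0 = 0"
    and "forward_complete D f"
    and "C1_fun V" and "\<forall>x. V x \<ge> 0"
    and "C1_fun W" and "\<forall>x. W x \<ge> 0" and "W 0 = 0"
    and "class_K_inf a"
    and "continuous_on {0..} chi" and "mono_on {0..} chi" and "\<forall>s\<ge>0. chi s \<ge> 0"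
    and "continuous_on {0..} \<rho>" and "positive_definite_fun \<rho>"
    and "\<forall>x. a (norm (h x)) \<le> W x"
    and "\<forall>x. \<forall>d\<in>D. W x \<ge> chi (norm d) \<longrightarrow> gradient V x \<bullet> f x d \<le> - \<rho> (W x)"
    and "\<forall>x. \<forall>d\<in>D. W x \<ge> chi (norm d) \<longrightarrow> gradient W x \<bullet> f x d \<le> 0"
  shows "p_IOS D f h (inv_into {0..} a \<circ> chi) \<and> (chi 0 = 0 \<longrightarrow> IOS D f h)"
proof -
  note V = assms(9,10) and W = assms(11-13) and chi = assms(15-17)
  note V_dec = assms(21) and W_dec = assms(22)
  note ai = class_K_inf_inverse[OF assms(14)]
  have ai_K: "continuous_on {0..} (inv_into {0..} a)" "strict_mono_on {0..} (inv_into {0..} a)"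
    "inv_into {0..} a 0 = 0"
    using ai(1) by (auto simp: class_K_def)
  obtain \<omega> E where \<omega>: "continuous_on {0..} \<omega>" "mono_on {0..} \<omega>"
      "\<And>w. w \<ge> 0 \<Longrightarrow> \<omega> w \<ge> 0" "\<And>w. w > 0 \<Longrightarrow> \<omega> w > 0"
    and E: "continuous_on {0..} E" "mono_on {0..} E" "\<And>n. n \<ge> 0 \<Longrightarrow> E n \<ge> 1"
    and \<omega>_le: "\<And>w r n. 0 \<le> w \<Longrightarrow> w \<le> r \<Longrightarrow> r \<le> n \<Longrightarrow> \<omega> w \<le> \<rho> r * E n"
    using positive_definite_lower_factorization[OF assms(18,19)] by blast
  obtain M where M: "continuous_on {0..} M" "mono_on {0..} M" "M 0 = V 0"
    "\<And>x. V x \<le> M (norm x)"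
    by (rule running_max[OF C1_fun_gradient(3)[OF V(1)]]) blast
  obtain N where N: "continuous_on {0..} N" "mono_on {0..} N" "N 0 = W 0"
    "\<And>x. W x \<le> N (norm x)"
    by (rule running_max[OF C1_fun_gradient(3)[OF W(1)]]) blast
  have M0: "M s \<ge> 0" if "s \<ge> 0" for s
    using mono_onD[OF M(2), of 0 s] M(3) V(2) that by (smt (verit) atLeast_iff)
  have N0: "N s \<ge> 0" if "s \<ge> 0" for s
    using mono_onD[OF N(2), of 0 s] N(3) W(3) that by auto
  \<comment> \<open>\<open>R\<close> is to bound \<open>\<omega> w * (1 + t)\<close>: the product
    bounds the part with \<open>t\<close> through the decrease of \<open>V\<close>, and
    \<open>\<omega> (N s)\<close> bounds the part with 1.\<close>
  define R where "R s = M s * E (N s) + \<omega> (N s)" for s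
  have R_cont: "continuous_on {0..} R" unfolding R_def
    by (intro continuous_intros M(1) continuous_on_compose2[OF E(1)] continuous_on_compose2[OF \<omega>(1)] N(1))
      (use N0 in auto)
  have R0: "R s \<ge> 0" if "s \<ge> 0" for s
    using M0 N0 E(3)[of "N s"] \<omega>(3) that unfolding R_def by (smt (verit) mult_nonneg_nonneg)
  have R_mono: "mono_on {0..} R" unfolding R_def
  proof (rule mono_onI)
    fix s t :: real assume st: "s \<in> {0..}" "t \<in> {0..}" "s \<le> t"
    then have Nst: "N s \<le> N t" "N s \<in> {0..}" "N t \<in> {0..}"
      using N0 mono_onD[OF N(2)] by auto
    have "M s * E (N s) \<le> M t * E (N t)"
      using mono_onD[OF M(2) st] mono_onD[OF E(2) Nst(2,3,1)] M0[of t] E(3)[of "N s"] st Nst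
      by (intro mult_mono) auto
    then show "M s * E (N s) + \<omega> (N s) \<le> M t * E (N t) + \<omega> (N t)"
      using mono_onD[OF \<omega>(2) Nst(2,3,1)] by simp
  qed
  \<comment> \<open>The factor \<open>N s\<close> makes \<open>T\<close> vanish at 0, since
    \<open>W 0 = 0\<close>; the summand \<open>s\<close> makes it strictly increasing.\<close>
  define T where "T s = N s * R s + s" for s
  have T_cont: "continuous_on {0..} T" unfolding T_def by (intro continuous_intros R_cont N(1))
  have T_mono: "strict_mono_on {0..} T" unfolding T_def
  proof (rule strict_mono_onI)
    fix s t :: real assume st: "s \<in> {0..}" "t \<in> {0..}" "s < t"
    then have "N s * R s \<le> N t * R t"
      using mono_onD[OF N(2), of s t] mono_onD[OF R_mono, of s t] N0[of t] R0[of s]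
      by (intro mult_mono) auto
    then show "N s * R s + s < N t * R t + t" using st by simp
  qed
  \<comment> \<open>Composing \<open>w * \<omega> w\<close> with \<open>a\<close> lets one inversion
    bound the output directly, because \<open>a (norm (h x)) \<le> W x\<close>.\<close>
  define A where "A x = a x * \<omega> (a x)" for x
  have A: "class_K_inf A"
    unfolding A_def by (rule class_K_inf_times_mono[OF assms(14) \<omega>])
  note Ai = class_K_inf_inverse[OF A]
  define \<beta> where "\<beta> s t = inv_into {0..} A (T s / (1 + t))" for s t
  have KL: "class_KL \<beta>" unfolding \<beta>_def
    by (rule class_KL_inverse_quotient[OF Ai(1) T_cont T_mono]) (simp add: T_def N(3) W(3))
  have T0: "T s \<ge> 0" if "s \<ge> 0" for s using N0 R0 that by (simp add: T_def)
  have \<beta>0: "\<beta> s t \<ge> 0" if "s \<ge> 0" "t \<ge> 0" for s t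
    unfolding \<beta>_def by (rule Ai(4)) (use T0 that in auto)
  have a_strict: "strict_mono_on {0..} a" and a0: "a 0 = 0"
    using assms(14) by (auto simp: class_K_inf_def class_K_def)

  have est: "norm (sys_output f h t x0 d) \<le> \<beta> (norm x0) t + (inv_into {0..} a \<circ> chi) (Linf_norm d)"
    if d: "Linf_input D d" and t: "t \<ge> 0" for x0 d t
  proof -
    \<comment> \<open>This is the same choice as in \<open>sol\<close>, which does not depend on the
      time, so one curve represents the output at all times.\<close>
    define \<phi> where "\<phi> = (SOME \<phi>. is_solution f x0 d \<phi>)"
    have sol: "is_solution f x0 d \<phi>"
    proof -
      have "\<exists>\<phi>. is_solution f x0 d \<phi>"
        using assms(8) Linf_input_imp_loc_ess_bounded[OF d] unfolding forward_complete_def by blast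
      then show ?thesis unfolding \<phi>_def by (rule someI_ex)
    qed
    have \<phi>0: "\<phi> 0 = x0" using sol by (auto simp: is_solution_def)
    obtain Z where Z: "negligible Z" "\<And>t. t \<ge> 0 \<Longrightarrow> t \<notin> Z \<Longrightarrow> norm (d t) \<le> Linf_norm d"
      and d0: "Linf_norm d \<ge> 0"
      using Linf_norm_bound[OF d] by blast
    define c where "c = chi (Linf_norm d)"
    have c0: "c \<ge> 0" using chi(3) d0 by (simp add: c_def)
    have dD: "d r \<in> D" if "r \<ge> 0" for r using d that by (simp add: Linf_input_def)
    have chi_le: "chi (norm (d r)) \<le> c" if "r \<ge> 0" "r \<notin> Z" for r
      unfolding c_def by (rule mono_onD[OF chi(2)]) (use Z(2)[OF that] d0 in auto)
    define w where "w = W (\<phi> t)"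
    define y where "y = norm (h (\<phi> t))"
    have y: "y \<ge> 0" "a y \<le> w" using assms(20) by (auto simp: y_def w_def)
    have "y \<le> \<beta> (norm x0) t + inv_into {0..} a c"
    \<comment> \<open>Inside the sublevel set the gain alone bounds the output; outside it the class
      KL term alone does.\<close>
    proof (cases "w \<le> c")
      case True
      have "y = inv_into {0..} a (a y)" using ai(3) y by simp
      also have "\<dots> \<le> inv_into {0..} a c"
        by (rule strict_mono_on_leD[OF ai_K(2)])
          (use y True c0 strict_mono_on_leD[OF a_strict, of 0 y] a0 in auto)
      finally show ?thesis using \<beta>0[of "norm x0" t] t by simp
    next
      case False
      \<comment> \<open>An earlier visit to the sublevel set would by invariance force
        \<open>w \<le> c\<close>. Thus both decrease conditions are available at almost every time
        in \<open>[0, t]\<close>.\<close>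
      have above: "W (\<phi> r) > c" if "0 \<le> r" "r \<le> t" for r
      proof (rule ccontr)
        assume "\<not> W (\<phi> r) > c"
        then have "W (\<phi> t) \<le> c"
          using W_dec chi_le dD that
          by (intro Lyapunov_sublevel_invariant[OF sol W(1) Z(1), of c r t]) fastforce+
        with False show False by (simp add: w_def)
      qed
      have W_noninc: "W (\<phi> r) \<le> W (\<phi> s)" if "0 \<le> s" "s \<le> r" "r \<le> t" for r s
      proof -
        have "W (\<phi> r) - W (\<phi> s) \<le> - 0 * (r - s)"
        proof (rule Lyapunov_decrease_along_solution[OF sol W(1) that(1,2) Z(1)])
          fix q assume "q \<in> {s..r} - Z"
          then show "gradient W (\<phi> q) \<bullet> f (\<phi> q) (d q) \<le> - 0"
            using W_dec dD[of q] chi_le[of q] above[of q] that by fastforce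
        qed
        then show ?thesis by simp
      qed
      define n where "n = N (norm x0)"
      have w_n: "w \<le> n" and w0: "w > 0" and n0: "n \<ge> 0"
        using W_noninc[of 0 t] N(4)[of x0] \<phi>0 t False c0 N0 by (auto simp: w_def n_def)
      have En: "E n \<ge> 1" using E(3) n0 by simp
      \<comment> \<open>Along \<open>[0, t]\<close> the values of \<open>W\<close> stay in
        \<open>[w, n]\<close>, where \<open>\<rho>\<close> is at least the constant
        \<open>\<omega> w / E n\<close>.\<close>
      have "V (\<phi> t) - V (\<phi> 0) \<le> - (\<omega> w / E n) * (t - 0)"
      proof (rule Lyapunov_decrease_along_solution[OF sol V(1) _ t Z(1)])
        fix q assume q: "q \<in> {0..t} - Z"
        have "w \<le> W (\<phi> q)" "W (\<phi> q) \<le> n"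
          using W_noninc[of q t] W_noninc[of 0 q] q N(4)[of x0] \<phi>0 by (auto simp: w_def n_def)
        then have "\<omega> w \<le> \<rho> (W (\<phi> q)) * E n" using \<omega>_le w0 by simp
        then have "\<omega> w / E n \<le> \<rho> (W (\<phi> q))" using En by (simp add: divide_le_eq)
        moreover have "gradient V (\<phi> q) \<bullet> f (\<phi> q) (d q) \<le> - \<rho> (W (\<phi> q))"
          using V_dec dD[of q] chi_le[of q] above[of q] q by fastforce
        ultimately show "gradient V (\<phi> q) \<bullet> f (\<phi> q) (d q) \<le> - (\<omega> w / E n)" by linarith
      qed simp
      then have "\<omega> w / E n * t \<le> M (norm x0)"
        using V(2) M(4)[of x0] \<phi>0 by (smt (verit) minus_mult_left)
      then have "\<omega> w * t \<le> M (norm x0) * E n" using En by (simp add: field_simps)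
      moreover have "\<omega> w \<le> \<omega> n" by (rule mono_onD[OF \<omega>(2)]) (use w_n w0 n0 in auto)
      ultimately have "\<omega> w * (1 + t) \<le> R (norm x0)"
        by (simp add: R_def n_def algebra_simps)
      \<comment> \<open>Multiplication by \<open>w \<le> n\<close> produces the factor
        \<open>n = N (norm x0)\<close>, which vanishes at \<open>x0 = 0\<close>.\<close>
      then have "w * (\<omega> w * (1 + t)) \<le> n * R (norm x0)"
        using w_n w0 n0 \<omega>(3)[of w] t by (intro mult_mono) auto
      also have "\<dots> \<le> T (norm x0)" by (simp add: T_def n_def)
      finally have wT: "w * \<omega> w \<le> T (norm x0) / (1 + t)" using t by (simp add: le_divide_eq mult.assoc)
      have ay: "a y \<ge> 0" using strict_mono_on_leD[OF a_strict, of 0 y] a0 y by simp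
      have "A y \<le> w * \<omega> w" unfolding A_def
        using ay y(2) \<omega>(3)[of "a y"] w0 by (intro mult_mono mono_onD[OF \<omega>(2)]) auto
      with wT have Ay: "A y \<le> T (norm x0) / (1 + t)" by simp
      have "y = inv_into {0..} A (A y)" using Ai(3) y by simp
      also have "\<dots> \<le> \<beta> (norm x0) t" unfolding \<beta>_def
        using Ai(1) Ay ay \<omega>(3)[OF ay] T0[of "norm x0"] t
        by (intro strict_mono_on_leD[of _ "inv_into {0..} A"]) (auto simp: class_K_def A_def)
      finally show ?thesis using ai(4)[OF c0] by simp
    qed
    then show ?thesis by (simp add: y_def c_def sys_output_def sol_def \<phi>_def)
  qed
  have "gain_fun (inv_into {0..} a \<circ> chi)"
    unfolding gain_fun_def
  proof (intro conjI allI impI)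
    show "continuous_on {0..} (inv_into {0..} a \<circ> chi)"
      unfolding o_def by (rule continuous_on_compose2[OF ai_K(1) chi(1)]) (auto simp: chi(3))
    show "mono_on {0..} (inv_into {0..} a \<circ> chi)"
    proof (rule mono_onI)
      fix r s :: real assume rs: "r \<in> {0..}" "s \<in> {0..}" "r \<le> s"
      then have "chi r \<le> chi s" by (rule mono_onD[OF chi(2)])
      then show "(inv_into {0..} a \<circ> chi) r \<le> (inv_into {0..} a \<circ> chi) s"
        using strict_mono_on_leD[OF ai_K(2), of "chi r" "chi s"] rs chi(3) by simp
    qed
    show "(inv_into {0..} a \<circ> chi) s \<ge> 0" if "s \<ge> 0" for s
      using ai(4)[of "chi s"] chi(3) that by simp
  qed
  then have "p_IOS D f h (inv_into {0..} a \<circ> chi)"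
    using KL est unfolding p_IOS_def by blast
  moreover have "(inv_into {0..} a \<circ> chi) 0 = 0" if "chi 0 = 0" using ai_K(3) that by simp
  ultimately show ?thesis unfolding IOS_def by blast
qed

end
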